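(* Let $n\ge 8$ be an integer and define $h(n)=2n$ if $n\equiv 0 \pmod 4$ and $h(n)=2n+1$ otherwise. Then the minimum number of edges of a $4$-connected locally nonforesty graph of order $n$ is $h(n)$; that is, every $4$-connected locally nonforesty graph of order $n$ has at least $h(n)$ edges, and there exists a $4$-connected locally nonforesty graph of order $n$ with exactly $h(n)$ edges.
   Context: All graphs are finite and simple. The order of a graph is its number of vertices and its size is its number of edges. For a vertex $v$ of a graph $G$, the local subgraph at $v$ is the subgraph of $G$ induced by the (open) neighborhood $N(v)$ of $v$. A graph $G$ is called locally nonforesty if every local subgraph of $G$ contains a cycle (equivalently, every vertex of $G$ is the hub of a wheel in $G$). *)

theory Defs
  imports "Graph_Theory.Graph_Theory"
begin

text \<open>
  Finite simple graphs are the library's \<open>graph\<close> locale: finite symmetric digraphs without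
  loops and parallel arcs. An undirected edge \<open>uv\<close> is represented by the two arcs
  from \<open>u\<close> to \<open>v\<close> and from \<open>v\<close> to \<open>u\<close>, so edges are
  counted as unordered pairs of end vertices, not as arcs.
\<close>

definition graph_edges :: "('a, 'b) pre_digraph \<Rightarrow> 'a set set" where
  "graph_edges G = (\<lambda>e. {tail G e, head G e}) ` arcs G"

definition graph_order :: "('a, 'b) pre_digraph \<Rightarrow> nat" where
  "graph_order G = card (verts G)"

definition graph_size :: "('a, 'b) pre_digraph \<Rightarrow> nat" where
  "graph_size G = card (graph_edges G)"

definition neighborhood :: "('a, 'b) pre_digraph \<Rightarrow> 'a \<Rightarrow> 'a set" where
  "neighborhood G v = {u. v \<rightarrow>\<^bsub>G\<^esub> u}"

definition local_subgraph :: "('a, 'b) pre_digraph \<Rightarrow> 'a \<Rightarrow> ('a, 'b) pre_digraph" where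
  "local_subgraph G v = G \<restriction> neighborhood G v"

text \<open>
  In a symmetric digraph the library's \<open>cycle\<close> also holds of the walk \<open>u, v, u\<close>
  along the two arcs of a single edge. The length bound excludes exactly these, leaving the
  cycles of the undirected graph. (For the same reason the library's \<open>forest\<close> cannot be used.)
\<close>

definition contains_cycle :: "('a, 'b) pre_digraph \<Rightarrow> bool" where
  "contains_cycle G \<longleftrightarrow> (\<exists>p. pre_digraph.cycle G p \<and> 3 \<le> length p)"

definition locally_nonforesty :: "('a, 'b) pre_digraph \<Rightarrow> bool" where
  "locally_nonforesty G \<longleftrightarrow> (\<forall>v \<in> verts G. contains_cycle (local_subgraph G v))"

definition k_connected :: "nat \<Rightarrow> ('a, 'b) pre_digraph \<Rightarrow> bool" where
  "k_connected k G \<longleftrightarrow> k < graph_order G \<and>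
     (\<forall>X. X \<subseteq> verts G \<and> card X < k \<longrightarrow> connected (G \<restriction> (verts G - X)))"

definition h :: "nat \<Rightarrow> nat" where
  "h n = (if n mod 4 = 0 then 2 * n else 2 * n + 1)"

end

theory Submission
  imports Defs
begin

text \<open>
  Lower bound: 4-connectivity forces minimum degree 4, hence at least \<open>2n\<close> edges. If there are
  exactly \<open>2n\<close>, every neighbourhood has four vertices and contains a triangle or a spanning
  4-cycle. A spanning 4-cycle forces an octahedron component or a 2-vertex cut, so every vertex lies
  in a \<open>K\<^sub>4\<close>; two distinct overlapping \<open>K\<^sub>4\<close>'s share three vertices and are cut off by the other
  two. So the \<open>K\<^sub>4\<close>'s partition the vertices and 4 divides \<open>n\<close>.

  Upper bound: a ring of blocks of four consecutive vertices, where the last block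
  takes the remaining vertices and is covered by two \<open>K\<^sub>4\<close>'s. Consecutive blocks are joined by two
  independent edges. If removing at most three vertices separated the rest, there would be two
  places on the ring where the component changes; each of them uses up two removed vertices,
  and two such places cannot share one.
\<close>

section \<open>Connectivity, cycles and degrees\<close>

lemma unordered_pair_fibre:
  assumes "(u, v) \<in> R" "(v, u) \<in> R"
  shows "{x \<in> R. (\<lambda>(u, v). {u, v}) x = {u, v}} = {(u, v), (v, u)}"
proof -
  have "x = (u, v) \<or> x = (v, u)" if "(\<lambda>(u, v). {u, v}) x = {u, v}" for x
    using that by (cases x) (simp add: doubleton_eq_iff)
  then show ?thesis using assms by (auto simp: insert_commute)
qed

context graph begin

text \<open>Both bounds use connectivity only through sets closed under adjacency: the vertices
  reachable from a point form such a set, and such a set contains everything reachable from it.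
  Symmetry of \<open>G\<close> makes directed reachability suffice.\<close>

lemma connected_induce_iff:
  assumes "S \<subseteq> verts G" "S \<noteq> {}"
  shows "connected (G \<restriction> S) \<longleftrightarrow>
    (\<forall>T \<subseteq> S. T \<noteq> {} \<and> (\<forall>u \<in> T. \<forall>v \<in> S. u \<rightarrow>\<^bsub>G\<^esub> v \<longrightarrow> v \<in> T) \<longrightarrow> T = S)"
proof -
  interpret H: wf_digraph "G \<restriction> S" by (rule wellformed_induce_subgraph)
  have dom: "u \<rightarrow>\<^bsub>G \<restriction> S\<^esub> v \<longleftrightarrow> u \<in> S \<and> v \<in> S \<and> u \<rightarrow>\<^bsub>G\<^esub> v" for u v
    by (auto simp: arcs_ends_conv)
  have "symmetric (G \<restriction> S)"
    using graph_symmetric by (auto simp: symmetric_def sym_def dom)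
  then have reach: "connected (G \<restriction> S) \<longleftrightarrow> (\<forall>u \<in> S. \<forall>v \<in> S. u \<rightarrow>\<^sup>*\<^bsub>G \<restriction> S\<^esub> v)"
    using assms H.reachable_mk_symmetric_eq
    by (auto simp: connected_def strongly_connected_def mk_symmetric_def)
  show ?thesis unfolding reach
  proof (intro iffI allI impI ballI)
    fix T assume r: "\<forall>u \<in> S. \<forall>v \<in> S. u \<rightarrow>\<^sup>*\<^bsub>G \<restriction> S\<^esub> v" and T: "T \<subseteq> S"
      and c: "T \<noteq> {} \<and> (\<forall>u \<in> T. \<forall>v \<in> S. u \<rightarrow>\<^bsub>G\<^esub> v \<longrightarrow> v \<in> T)"
    from c obtain u where u: "u \<in> T" by blast
    have "v \<in> T" if "u \<rightarrow>\<^sup>*\<^bsub>G \<restriction> S\<^esub> v" for v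
      using that u by (induct rule: H.reachable_induct) (use c dom in blast)+
    with r u T show "T = S" by blast
  next
    fix u v
    assume c: "\<forall>T \<subseteq> S. T \<noteq> {} \<and> (\<forall>u \<in> T. \<forall>v \<in> S. u \<rightarrow>\<^bsub>G\<^esub> v \<longrightarrow> v \<in> T) \<longrightarrow> T = S"
      and u: "u \<in> S" and v: "v \<in> S"
    let ?T = "{w \<in> S. u \<rightarrow>\<^sup>*\<^bsub>G \<restriction> S\<^esub> w}"
    have "u \<in> ?T" using u by auto
    moreover have "\<forall>w \<in> ?T. \<forall>v \<in> S. w \<rightarrow>\<^bsub>G\<^esub> v \<longrightarrow> v \<in> ?T"
      using H.reachable_adj_trans dom by blast
    moreover have "?T \<subseteq> S" by simp
    ultimately have "?T = S" by (intro c[THEN spec, THEN mp, THEN mp] conjI) blast+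
    with v show "u \<rightarrow>\<^sup>*\<^bsub>G \<restriction> S\<^esub> v" by blast
  qed
qed

text \<open>The arcs of a cycle have distinct heads, so its length is at most \<open>card N\<close>,
  and a cycle of length four visits all of \<open>N\<close>.\<close>

lemma cycle_on_three_or_four_vertices:
  assumes "pre_digraph.cycle (G \<restriction> N) p" "3 \<le> length p" "finite N" "card N \<le> 4"
  obtains a b c where "{a, b, c} \<subseteq> N" "distinct [a, b, c]" "a \<rightarrow>\<^bsub>G\<^esub> b" "b \<rightarrow>\<^bsub>G\<^esub> c" "c \<rightarrow>\<^bsub>G\<^esub> a"
  | a b c d where "N = {a, b, c, d}" "distinct [a, b, c, d]"
      "a \<rightarrow>\<^bsub>G\<^esub> b" "b \<rightarrow>\<^bsub>G\<^esub> c" "c \<rightarrow>\<^bsub>G\<^esub> d" "d \<rightarrow>\<^bsub>G\<^esub> a"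
proof -
  interpret H: wf_digraph "G \<restriction> N" by (rule wellformed_induce_subgraph)
  have dom: "tail G e \<rightarrow>\<^bsub>G\<^esub> head G e" if "e \<in> arcs G" for e
    using that by (auto simp: arcs_ends_conv)
  from assms(1) obtain u where u: "H.awalk u p u" "distinct (tl (H.awalk_verts u p))"
    unfolding H.cycle_def by blast
  then have arcs: "set p \<subseteq> {e \<in> arcs G. tail G e \<in> N \<and> head G e \<in> N}" and cas: "H.cas u p u"
    by (auto simp: H.awalk_def)
  have "tl (H.awalk_verts u p) = map (head G) p"
    using H.awalk_verts_conv'[OF cas] assms(2) by auto
  with u have dist: "distinct (map (head G) p)" by simp
  then have "card (set (map (head G) p)) = length p" using distinct_card by fastforce
  moreover have sub: "set (map (head G) p) \<subseteq> N" using arcs by auto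
  ultimately have "length p \<le> card N" using card_mono[OF assms(3)] by metis
  then consider "length p = 3" | "length p = 4" using assms by linarith
  then show thesis
  proof cases
    case 1
    then obtain e f g where p: "p = [e, f, g]" by (auto simp: numeral_3_eq_3 length_Suc_conv)
    show thesis
      by (rule that(1)[of "head G e" "head G f" "head G g"])
        (use p sub dist cas arcs dom[of e] dom[of f] dom[of g] in auto)
  next
    case 2
    then obtain e f g k where p: "p = [e, f, g, k]" by (auto simp: numeral_eq_Suc length_Suc_conv)
    have "N = set (map (head G) p)"
      using card_subset_eq[OF assms(3) sub] \<open>card (set (map (head G) p)) = length p\<close> 2 assms
        card_mono[OF assms(3) sub] by simp
    then have N: "N = {head G e, head G f, head G g, head G k}" unfolding p by simp
    show thesis
      by (rule that(2)[OF N]) (use p dist cas arcs dom[of e] dom[of f] dom[of g] dom[of k] in auto)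
  qed
qed

lemma contains_cycle_if_triangle:
  assumes "{a, b, c} \<subseteq> N" "distinct [a, b, c]" "a \<rightarrow>\<^bsub>G\<^esub> b" "b \<rightarrow>\<^bsub>G\<^esub> c" "c \<rightarrow>\<^bsub>G\<^esub> a"
  shows "contains_cycle (G \<restriction> N)"
proof -
  interpret H: wf_digraph "G \<restriction> N" by (rule wellformed_induce_subgraph)
  obtain e f g where "{e, f, g} \<subseteq> arcs G" "tail G e = a" "head G e = b"
    "tail G f = b" "head G f = c" "tail G g = c" "head G g = a"
    using assms(3-5) by (auto simp: arcs_ends_conv)
  with assms(1,2) have "H.cycle [e, f, g]"
    unfolding H.cycle_def H.awalk_def by (intro exI[of _ a]) auto
  then show ?thesis unfolding contains_cycle_def by fastforce
qed

section \<open>Neighbourhoods and the degree sum\<close>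

lemma neighborhood_subset: "neighborhood G v \<subseteq> verts G"
  by (auto simp: neighborhood_def)

lemma finite_neighborhood [simp]: "finite (neighborhood G v)"
  using finite_subset[OF neighborhood_subset] by simp

lemma neighborhood_sym: "u \<in> neighborhood G v \<longleftrightarrow> v \<in> neighborhood G u"
  unfolding neighborhood_def using graph_symmetric by blast

lemma not_self_neighbor: "v \<notin> neighborhood G v"
  using no_loops by (auto simp: neighborhood_def arcs_ends_conv)

text \<open>Double counting of \<open>arcs_ends G\<close>: by first vertex, and by the fibres of the
  map that forgets orientation.\<close>

lemma handshake: "(\<Sum>v \<in> verts G. card (neighborhood G v)) = 2 * graph_size G"
proof -
  let ?R = "arcs_ends G" and ?f = "\<lambda>(u, v). {u, v}"
  have fin: "finite ?R" by (simp add: arcs_ends_def)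
  have "?R = Sigma (verts G) (neighborhood G)"
    by (auto simp: neighborhood_def)
  then have "(\<Sum>v \<in> verts G. card (neighborhood G v)) = card ?R" by simp
  also have "\<dots> = (\<Sum>e \<in> ?f ` ?R. card {x \<in> ?R. ?f x = e})"
    using sum.image_gen[OF fin, of "\<lambda>_. 1::nat" ?f] by simp
  also have "\<dots> = (\<Sum>e \<in> ?f ` ?R. 2)"
  proof (rule sum.cong)
    fix e assume "e \<in> ?f ` ?R"
    then obtain u v where e: "e = {u, v}" and uv: "(u, v) \<in> ?R" by auto
    have "{x \<in> ?R. ?f x = e} = {(u, v), (v, u)}"
      unfolding e by (rule unordered_pair_fibre[OF uv graph_symmetric[OF uv]])
    moreover have "u \<noteq> v" using uv not_self_neighbor by (auto simp: neighborhood_def)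
    ultimately show "card {x \<in> ?R. ?f x = e} = 2" by simp
  qed simp
  also have "?f ` ?R = graph_edges G"
    by (auto simp: graph_edges_def arcs_ends_conv image_image)
  finally show ?thesis by (simp add: graph_size_def)
qed

end

section \<open>The lower bound\<close>

context graph begin

text \<open>\<open>T\<close> is closed in the graph left after deleting \<open>X\<close>, which is
  connected because \<open>X\<close> is too small. Applied to a small explicit \<open>T\<close>,
  this bounds the order of the graph.\<close>

lemma k_connected_separation:
  assumes "k_connected k G" "T \<subseteq> verts G" "T \<noteq> {}" "X \<subseteq> verts G" "card X < k"
    and "T \<inter> X = {}" "\<And>u. u \<in> T \<Longrightarrow> neighborhood G u \<subseteq> T \<union> X"
  shows "verts G = T \<union> X"
proof -
  have "connected (G \<restriction> (verts G - X))" using assms(1,4,5) by (simp add: k_connected_def)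
  moreover have "T \<subseteq> verts G - X" using assms by blast
  moreover have "\<forall>u \<in> T. \<forall>v \<in> verts G - X. u \<rightarrow> v \<longrightarrow> v \<in> T"
    using assms(7) by (auto simp: neighborhood_def)
  ultimately have "T = verts G - X"
    using connected_induce_iff[of "verts G - X"] \<open>T \<noteq> {}\<close> by blast
  then show ?thesis using assms by blast
qed

text \<open>Deleting fewer than \<open>k\<close> neighbours would isolate \<open>v\<close>, so the
  whole graph would have at most \<open>k\<close> vertices.\<close>

lemma k_connected_min_degree:
  assumes "k_connected k G" "v \<in> verts G"
  shows "k \<le> card (neighborhood G v)"
proof (rule ccontr)
  assume "\<not> ?thesis"
  then have small: "card (neighborhood G v) < k" by simp
  then have "verts G = {v} \<union> neighborhood G v"
    using assms neighborhood_subset not_self_neighbor by (intro k_connected_separation) auto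
  then have "card (verts G) \<le> k" using small not_self_neighbor by simp
  then show False using assms(1) by (simp add: k_connected_def graph_order_def)
qed

definition clique4 :: "'a set \<Rightarrow> bool" where
  "clique4 Q \<longleftrightarrow> Q \<subseteq> verts G \<and> card Q = 4 \<and> (\<forall>x \<in> Q. \<forall>y \<in> Q. x \<noteq> y \<longrightarrow> y \<in> neighborhood G x)"

end

section \<open>The case of equality: 4-regular graphs\<close>

locale four_regular_graph = graph +
  assumes four_connected: "k_connected 4 G"
    and locally_nonforesty: "locally_nonforesty G"
    and degree_four: "v \<in> verts G \<Longrightarrow> card (neighborhood G v) = 4"
    and order_ge_8: "8 \<le> card (verts G)"
begin

lemma neighborhood_eqI:
  assumes "v \<in> verts G" "{a, b, c, d} \<subseteq> neighborhood G v" "distinct [a, b, c, d]"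
  shows "neighborhood G v = {a, b, c, d}"
  using card_subset_eq[OF finite_neighborhood assms(2)] degree_four[OF assms(1)] assms(3) by simp

lemma local_cycle:
  assumes "v \<in> verts G"
  obtains a b c where "{a, b, c} \<subseteq> neighborhood G v" "distinct [a, b, c]"
      "b \<in> neighborhood G a" "c \<in> neighborhood G b" "a \<in> neighborhood G c"
  | a b c d where "neighborhood G v = {a, b, c, d}" "distinct [a, b, c, d]"
      "b \<in> neighborhood G a" "c \<in> neighborhood G b" "d \<in> neighborhood G c" "a \<in> neighborhood G d"
proof -
  obtain p where "pre_digraph.cycle (G \<restriction> neighborhood G v) p" "3 \<le> length p"
    using locally_nonforesty assms
    by (auto simp: locally_nonforesty_def contains_cycle_def local_subgraph_def)
  then show thesis
    by (rule cycle_on_three_or_four_vertices[OF _ _ finite_neighborhood])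
      (use degree_four[OF assms] that in \<open>simp_all add: neighborhood_def\<close>)
qed

text \<open>The 4-cycle case of \<open>local_cycle\<close>: \<open>v\<close> is the hub and
  \<open>a, b, c, d\<close> the rim in cyclic order; chords are not excluded here.\<close>

definition wheel4 :: "'a \<Rightarrow> 'a \<Rightarrow> 'a \<Rightarrow> 'a \<Rightarrow> 'a \<Rightarrow> bool" where
  "wheel4 v a b c d \<longleftrightarrow> v \<in> verts G \<and> neighborhood G v = {a, b, c, d} \<and> distinct [a, b, c, d] \<and>
     b \<in> neighborhood G a \<and> c \<in> neighborhood G b \<and> d \<in> neighborhood G c \<and> a \<in> neighborhood G d"

lemma wheel4_rotate: "wheel4 v a b c d \<Longrightarrow> wheel4 v b c d a"
  by (auto simp: wheel4_def)

lemma wheel4_adjacent: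
  assumes "wheel4 v a b c d"
  shows "{v, a, b, c, d} \<subseteq> verts G" "distinct [v, a, b, c, d]" "{v, b, d} \<subseteq> neighborhood G a"
proof -
  show "{v, a, b, c, d} \<subseteq> verts G"
    using assms neighborhood_subset[of v] by (auto simp: wheel4_def)
  show "distinct [v, a, b, c, d]"
    using assms not_self_neighbor[of v] by (auto simp: wheel4_def)
  show "{v, b, d} \<subseteq> neighborhood G a"
    using assms neighborhood_sym[of v a] neighborhood_sym[of d a] by (simp add: wheel4_def)
qed

text \<open>With a chord, \<open>v\<close>, \<open>a\<close> and \<open>c\<close> would have all
  their neighbours among the five wheel vertices, so \<open>b\<close> and \<open>d\<close> would cut
  them off and the graph would have at most five vertices.\<close>

lemma wheel4_chordless:
  assumes w: "wheel4 v a b c d"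
  shows "c \<notin> neighborhood G a"
proof
  assume c: "c \<in> neighborhood G a"
  then have a: "a \<in> neighborhood G c" by (simp add: neighborhood_sym)
  note w' = wheel4_rotate[OF wheel4_rotate[OF w]]
  note adj = wheel4_adjacent[OF w] wheel4_adjacent(3)[OF w']
  have "neighborhood G a = {v, b, d, c}" using adj c by (intro neighborhood_eqI) auto
  moreover have "neighborhood G c = {v, d, b, a}" using adj a by (intro neighborhood_eqI) auto
  moreover have "neighborhood G v = {a, b, c, d}" using w by (simp add: wheel4_def)
  ultimately have "verts G = {v, a, c} \<union> {b, d}"
    using adj by (intro k_connected_separation[OF four_connected]) auto
  moreover have "card ({v, a, c} \<union> {b, d}) \<le> 3 + 2"
    by (intro order_trans[OF card_Un_le] add_mono) (simp_all add: card_insert_if)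
  ultimately show False using order_ge_8 by simp
qed

text \<open>The fourth neighbour of a rim vertex closes the only possible cycle in its neighbourhood.\<close>

lemma wheel4_outer:
  assumes w: "wheel4 v a b c d"
  obtains e where "neighborhood G a = {v, b, d, e}" "e \<notin> {v, a, b, c, d}"
    "e \<in> neighborhood G b" "e \<in> neighborhood G d"
proof -
  note adj = wheel4_adjacent[OF w]
  have av: "a \<in> verts G" using adj by simp
  have "card {v, b, d} = 3" using adj(2) by simp
  then have "card (neighborhood G a - {v, b, d}) = 1"
    using card_Diff_subset[OF _ adj(3)] degree_four[OF av] by simp
  then obtain e where "neighborhood G a - {v, b, d} = {e}" by (auto simp: card_1_singleton_iff)
  then have e: "e \<in> neighborhood G a" "e \<notin> {v, b, d}" by auto
  then have Na: "neighborhood G a = {v, b, d, e}" using adj by (intro neighborhood_eqI) auto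
  have e': "e \<notin> {v, a, b, c, d}" using e wheel4_chordless[OF w] not_self_neighbor[of a] by auto
  then have ve: "e \<notin> neighborhood G v" "v \<notin> neighborhood G e"
    using w neighborhood_sym[of e v] by (auto simp: wheel4_def)
  have bd: "d \<notin> neighborhood G b" "b \<notin> neighborhood G d"
    using wheel4_chordless[OF wheel4_rotate[OF w]] neighborhood_sym by auto
  from av have "e \<in> neighborhood G b \<and> e \<in> neighborhood G d"
  proof (cases rule: local_cycle)
    case (1 x y z)
    note tri = 1(3-5) 1(3-5)[THEN neighborhood_sym[THEN iffD1]]
    have pairs: "q \<in> neighborhood G p" if "p \<in> {x, y, z}" "q \<in> {x, y, z}" "p \<noteq> q" for p q
      using that tri by auto
    have "card {x, y, z} = 3" using 1(2) by simp
    \<comment> \<open>\<open>v\<close> and \<open>e\<close> are non-adjacent, and so are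
      \<open>b\<close> and \<open>d\<close>. Any three of these four vertices include one of the two
      pairs, so there is no triangle.\<close>
    have "{v, e} \<subseteq> {x, y, z} \<or> {b, d} \<subseteq> {x, y, z}"
    proof (rule ccontr)
      assume "\<not> ?thesis"
      then obtain p q where "p \<in> {v, e}" "q \<in> {b, d}" "p \<notin> {x, y, z}" "q \<notin> {x, y, z}" by blast
      then have sub: "{x, y, z} \<subseteq> {v, b, d, e} - {p, q}" and "p \<noteq> q" "{p, q} \<subseteq> {v, b, d, e}"
        using 1(1) adj(2) e' unfolding Na by auto
      moreover have "card {v, b, d, e} \<le> 4" using degree_four[OF av] Na by simp
      ultimately have "card ({v, b, d, e} - {p, q}) \<le> 2" by (subst card_Diff_subset) auto
      moreover have "card {x, y, z} \<le> card ({v, b, d, e} - {p, q})"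
        by (rule card_mono) (use sub in auto)
      ultimately show False using \<open>card {x, y, z} = 3\<close> by simp
    qed
    then show ?thesis using pairs[of v e] pairs[of b d] ve bd adj(2) e' by auto
  next
    case (2 x y z t)
    note cyc = 2(3-6) 2(3-6)[THEN neighborhood_sym[THEN iffD1]]
    have dist: "x \<noteq> z" "y \<noteq> t" using 2(2) by auto
    have xz: "x \<in> neighborhood G a" "z \<in> neighborhood G a" and yt: "y \<in> neighborhood G a" "t \<in> neighborhood G a"
      unfolding 2(1) by simp_all
    \<comment> \<open>On the 4-cycle \<open>e\<close> has two distinct neighbours \<open>p\<close>
      and \<open>q\<close>; neither is \<open>v\<close>, so they are \<open>b\<close> and
      \<open>d\<close>.\<close>
    from e(1) have "e = x \<or> e = y \<or> e = z \<or> e = t" unfolding 2(1) by simp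
    then have "(e \<in> neighborhood G x \<and> e \<in> neighborhood G z) \<or> (e \<in> neighborhood G y \<and> e \<in> neighborhood G t)"
      using cyc by (elim disjE) simp_all
    then obtain p q where pq: "p \<noteq> q" "p \<in> neighborhood G a" "q \<in> neighborhood G a"
      "e \<in> neighborhood G p" "e \<in> neighborhood G q"
      using dist xz yt by (elim disjE conjE) (rule that; assumption)+
    have "p \<noteq> e" "q \<noteq> e" "p \<noteq> v" "q \<noteq> v" using pq(4,5) ve(1) not_self_neighbor[of e] by auto
    then have "p \<in> {b, d}" "q \<in> {b, d}" using pq(2,3) unfolding Na by simp_all
    then show ?thesis using pq(1,4,5) by auto
  qed
  then show thesis using that[OF Na e'] by blast
qed

text \<open>The outer vertices of \<open>a\<close> and of \<open>c\<close> coincide, both being the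
  fourth neighbour of \<open>d\<close>. The resulting octahedron has no neighbours outside and is
  too small to be the whole graph.\<close>

lemma no_wheel4: "\<not> wheel4 v a b c d"
proof
  assume w: "wheel4 v a b c d"
  note w1 = wheel4_rotate[OF w]
  note w2 = wheel4_rotate[OF w1]
  note w3 = wheel4_rotate[OF w2]
  note adj = wheel4_adjacent(1,2)[OF w] wheel4_adjacent(3)[OF w]
    wheel4_adjacent(3)[OF w1] wheel4_adjacent(3)[OF w2] wheel4_adjacent(3)[OF w3]
  from wheel4_outer[OF w] obtain e where Na: "neighborhood G a = {v, b, d, e}"
    and e: "e \<notin> {v, a, b, c, d}" "e \<in> neighborhood G b" "e \<in> neighborhood G d" by blast
  have Nb: "neighborhood G b = {v, c, a, e}" using adj e by (intro neighborhood_eqI) auto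
  have Nd: "neighborhood G d = {v, a, c, e}" using adj e by (intro neighborhood_eqI) auto
  from wheel4_outer[OF w2] obtain e' where Nc: "neighborhood G c = {v, d, b, e'}"
    and e': "e' \<notin> {v, c, d, a, b}" "e' \<in> neighborhood G d" by blast
  have "e' = e" using e' Nd by auto
  then have "a \<in> neighborhood G e" "b \<in> neighborhood G e" "c \<in> neighborhood G e" "d \<in> neighborhood G e"
    using Na Nb Nc Nd neighborhood_sym[of _ e] by simp_all
  moreover have ev: "e \<in> verts G" using e(2) neighborhood_subset by blast
  ultimately have "neighborhood G e = {a, b, c, d}" using adj(2) by (intro neighborhood_eqI) auto
  moreover have "neighborhood G v = {a, b, c, d}" using w by (simp add: wheel4_def)
  ultimately have closed: "neighborhood G u \<subseteq> {v, a, b, c, d, e} \<union> {}"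
    if "u \<in> {v, a, b, c, d, e}" for u
    using that by (elim insertE) (simp_all add: Na Nb Nc Nd \<open>e' = e\<close>)
  have "verts G = {v, a, b, c, d, e} \<union> {}"
    by (rule k_connected_separation[OF four_connected _ _ _ _ _ closed]) (use adj(1) ev in simp_all)
  moreover have "card {v, a, b, c, d, e} \<le> 6"
    by (rule order_trans[OF card_length[of "[v, a, b, c, d, e]", simplified list.set]]) simp
  ultimately show False using order_ge_8 by simp
qed

section \<open>Partition of the vertices into cliques of order four\<close>

lemma clique4_exists:
  assumes v: "v \<in> verts G"
  shows "\<exists>Q. clique4 Q \<and> v \<in> Q"
  using v
proof (cases rule: local_cycle)
  case (1 a b c)
  have adj: "a \<in> neighborhood G v" "b \<in> neighborhood G v" "c \<in> neighborhood G v"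
    using 1 by auto
  note adj' = adj adj[THEN neighborhood_sym[THEN iffD1]] 1(3-5) 1(3-5)[THEN neighborhood_sym[THEN iffD1]]
  have "v \<notin> {a, b, c}" using adj not_self_neighbor[of v] by auto
  then have "card {v, a, b, c} = 4" using 1(2) by simp
  moreover have "{v, a, b, c} \<subseteq> verts G" using adj v neighborhood_subset[of v] by auto
  ultimately have "clique4 {v, a, b, c}" using adj' by (simp add: clique4_def)
  then show ?thesis by blast
next
  case (2 a b c d)
  then have "wheel4 v a b c d" using v by (simp add: wheel4_def)
  then show ?thesis using no_wheel4 by blast
qed

text \<open>A shared vertex has only four neighbours, so \<open>Q \<union> R\<close> has five
  vertices, three of them shared. The shared ones have no neighbours outside the union, so the two
  unshared ones cut them off.\<close>

lemma clique4_disjoint: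
  assumes Q: "clique4 Q" and R: "clique4 R" and "Q \<noteq> R"
  shows "Q \<inter> R = {}"
proof (rule ccontr)
  assume "Q \<inter> R \<noteq> {}"
  then obtain v where v: "v \<in> Q" "v \<in> R" by blast
  have sub: "Q \<subseteq> verts G" "R \<subseteq> verts G" and card4: "card Q = 4" "card R = 4"
    using Q R by (simp_all add: clique4_def)
  have fin: "finite Q" "finite R"
    using finite_subset[OF sub(1)] finite_subset[OF sub(2)] by simp_all
  have nb: "(Q \<union> R) - {u} \<subseteq> neighborhood G u" if "u \<in> Q \<inter> R" for u
  proof
    fix x assume "x \<in> (Q \<union> R) - {u}"
    then show "x \<in> neighborhood G u" using Q R that by (auto simp: clique4_def)
  qed
  have "card ((Q \<union> R) - {v}) \<le> 4"
    using card_mono[OF finite_neighborhood nb[of v]] degree_four[of v] v sub by auto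
  then have le: "card (Q \<union> R) \<le> 5" using v fin by simp
  have "\<not> R \<subseteq> Q" using card_subset_eq[OF fin(1), of R] card4 \<open>Q \<noteq> R\<close> by auto
  then have "4 < card (Q \<union> R)"
    using psubset_card_mono[of "Q \<union> R" Q] fin card4 by auto
  with le have card5: "card (Q \<union> R) = 5" by simp
  then have card3: "card (Q \<inter> R) = 3"
    using card_Un_Int[OF fin] card4 by simp
  have eq: "neighborhood G u = (Q \<union> R) - {u}" if "u \<in> Q \<inter> R" for u
  proof -
    have "card ((Q \<union> R) - {u}) = card (neighborhood G u)"
      using degree_four[of u] that card5 fin sub by auto
    then show ?thesis using card_subset_eq[OF finite_neighborhood nb[OF that]] by simp
  qed
  have "card ((Q \<union> R) - (Q \<inter> R)) = 2"
    using card5 card3 fin by (subst card_Diff_subset) auto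
  then have "verts G = (Q \<inter> R) \<union> ((Q \<union> R) - (Q \<inter> R))"
    using v sub eq by (intro k_connected_separation[OF four_connected]) auto
  also have "\<dots> = Q \<union> R" by blast
  finally show False using order_ge_8 card5 by simp
qed

lemma four_dvd_order: "4 dvd card (verts G)"
proof -
  let ?C = "{Q. clique4 Q}"
  have U: "\<Union> ?C = verts G" using clique4_exists by (auto simp: clique4_def)
  have "finite ?C" by (rule finite_subset[of _ "Pow (verts G)"]) (auto simp: clique4_def)
  moreover have "\<forall>Q \<in> ?C. card Q = 4" by (simp add: clique4_def)
  moreover have "Q \<inter> R = {}" if "Q \<in> ?C" "R \<in> ?C" "Q \<noteq> R" for Q R
    using that clique4_disjoint by simp
  ultimately have "4 * card ?C = card (\<Union> ?C)" by (intro card_partition) (simp_all add: U)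
  with U show ?thesis by (metis dvd_triv_left)
qed

end

text \<open>Minimum degree four makes the size at least twice the order. In case of equality the
  degree sum forces every degree to be four, and then 4 divides the order.\<close>

lemma (in graph) graph_size_ge_h:
  assumes "k_connected 4 G" "locally_nonforesty G" "8 \<le> graph_order G"
  shows "h (graph_order G) \<le> graph_size G"
proof -
  have deg: "4 \<le> card (neighborhood G v)" if "v \<in> verts G" for v
    using k_connected_min_degree[OF assms(1) that] .
  have "4 * card (verts G) = (\<Sum>v \<in> verts G. 4)" by simp
  also have "\<dots> \<le> (\<Sum>v \<in> verts G. card (neighborhood G v))" by (intro sum_mono deg)
  finally have le: "2 * graph_order G \<le> graph_size G"
    unfolding handshake by (simp add: graph_order_def)
  have "4 dvd graph_order G" if eq: "graph_size G = 2 * graph_order G"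
  proof -
    have "card (neighborhood G v) = 4" if "v \<in> verts G" for v
    proof (rule ccontr)
      assume "card (neighborhood G v) \<noteq> 4"
      then have "(\<Sum>v \<in> verts G. 4) < (\<Sum>v \<in> verts G. card (neighborhood G v))"
        using deg that by (intro sum_strict_mono_ex1) (auto simp: le_less intro!: bexI[of _ v])
      then show False using eq unfolding handshake by (simp add: graph_order_def)
    qed
    then interpret four_regular_graph G
      using assms by unfold_locales (auto simp: graph_order_def)
    show ?thesis using four_dvd_order by (simp add: graph_order_def)
  qed
  with le show ?thesis unfolding h_def by (cases "graph_size G = 2 * graph_order G") auto
qed

section \<open>Colourings of a ring\<close>

text \<open>The constraint that an edge puts on the colours of its ends; a removed end imposes
  nothing.\<close>

definition compatible_colours :: "'a option \<Rightarrow> 'a option \<Rightarrow> bool" where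
  "compatible_colours a b \<longleftrightarrow> a = None \<or> b = None \<or> a = b"

text \<open>
  A periodic colouring of the integers stands for a ring of \<open>n\<close> vertices of which those
  coloured \<open>None\<close> are removed; the other colours are constant on components. \<open>bd x\<close> says that
  a block ends at \<open>x\<close>, so that the edge from \<open>x\<close> to \<open>x + 1\<close> is missing.
\<close>

locale coloured_ring =
  fixes n :: int and c :: "int \<Rightarrow> bool option" and bd :: "int \<Rightarrow> bool"
  assumes n8: "8 \<le> n"
    and c_mod: "x mod n = y mod n \<Longrightarrow> c x = c y"
    and bd_mod: "x mod n = y mod n \<Longrightarrow> bd x = bd y"
    and few: "card {x \<in> {0..<n}. c x = None} \<le> 3"
    and step1: "\<not> bd x \<Longrightarrow> compatible_colours (c x) (c (x + 1))"
    and step2: "compatible_colours (c x) (c (x + 2))"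
    and step3_left: "bd x \<Longrightarrow> compatible_colours (c (x - 3)) (c x)"
    and step3_right: "bd x \<Longrightarrow> compatible_colours (c (x + 1)) (c (x + 4))"
    and bd_gap1: "bd x \<Longrightarrow> \<not> bd (x + 1)"
    and bd_gap3: "bd x \<Longrightarrow> \<not> bd (x + 3)"
begin

text \<open>
  What must be seen around the last vertex \<open>k\<close> of colour \<open>p\<close> before the colour changes. In every
  case \<open>k + 2\<close> is removed, which tells different transitions apart.
\<close>

definition transition :: "bool \<Rightarrow> int \<Rightarrow> bool" where
  "transition p k \<longleftrightarrow> c k = Some p \<and> c (k + 2) = None \<and>
     (c (k + 1) = None \<and> (c (k + 3) = None \<or> c (k + 3) = Some (\<not> p)) \<or>
      c (k + 1) = Some (\<not> p) \<and> c (k - 1) = None \<and> bd k)"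

section \<open>Positions modulo the period\<close>

lemma transition_mod:
  assumes "x mod n = y mod n" shows "transition p x = transition p y"
proof -
  have "(x + k) mod n = (y + k) mod n" for k by (metis assms mod_add_cong)
  then have "c (x + k) = c (y + k)" for k by (intro c_mod)
  from this[of 0] this[of 1] this[of 2] this[of 3] this[of "-1"] bd_mod[OF assms]
  show ?thesis unfolding transition_def by simp
qed

lemma distinct_mod:
  assumes "\<bar>x - y\<bar> < n" "x \<noteq> y" shows "x mod n \<noteq> y mod n"
proof
  assume "x mod n = y mod n"
  then have "n dvd x - y" by (simp add: mod_eq_dvd_iff)
  with assms show False using zdvd_imp_le[of n "\<bar>x - y\<bar>"] by auto
qed

lemma at_most_three_removed:
  assumes "c x = None" "c y = None" "c z = None" "c w = None"
  shows "x mod n = y mod n \<or> x mod n = z mod n \<or> x mod n = w mod n \<or>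
    y mod n = z mod n \<or> y mod n = w mod n \<or> z mod n = w mod n"
proof (rule ccontr)
  assume a: "\<not> ?thesis"
  have "c (u mod n) = c u" for u by (rule c_mod) simp
  then have "{x mod n, y mod n, z mod n, w mod n} \<subseteq> {x \<in> {0..<n}. c x = None}"
    using assms n8 by auto
  moreover have "finite {x \<in> {0..<n}. c x = None}" by (rule finite_subset[of _ "{0..<n}"]) auto
  ultimately have "card {x mod n, y mod n, z mod n, w mod n} \<le> card {x \<in> {0..<n}. c x = None}"
    using card_mono by blast
  moreover have "card {x mod n, y mod n, z mod n, w mod n} = 4" using a by simp
  ultimately show False using few by simp
qed

lemma no_four_removed_in_period:
  assumes "c x = None" "c y = None" "c z = None" "c w = None" "x < y" "y < z" "z < w" "w < x + n"
  shows False
proof -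
  have "x mod n \<noteq> y mod n" "x mod n \<noteq> z mod n" "x mod n \<noteq> w mod n"
    "y mod n \<noteq> z mod n" "y mod n \<noteq> w mod n" "z mod n \<noteq> w mod n"
    using assms(5-8) by (intro distinct_mod; linarith)+
  then show False using at_most_three_removed[OF assms(1-4)] by metis
qed

lemma transition_exists:
  assumes "c i = Some p" "c j = Some (\<not> p)" "i < j"
  shows "\<exists>k. transition p k"
proof -
  \<comment> \<open>\<open>k\<close> is the last position of colour \<open>p\<close> up to
    \<open>j\<close>, and \<open>l\<close> below is the first one of the other colour after it, so
    everything in between is removed.\<close>
  define S where "S = {k \<in> {i..j}. c k = Some p}"
  define k where "k = Max S"
  have S: "finite S" "i \<in> S" unfolding S_def using assms by (auto intro: finite_subset[of _ "{i..j}"])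
  then have kS: "k \<in> S" unfolding k_def by (intro Max_in) auto
  then have k: "c k = Some p" "k < j" using assms unfolding S_def by (auto simp: less_le)
  have after: "c x \<noteq> Some p" if "k < x" "x \<le> j" for x
  proof
    assume "c x = Some p"
    then have "x \<in> S" using kS that unfolding S_def by simp
    then have "x \<le> k" unfolding k_def using S by simp
    with that show False by simp
  qed
  define R where "R = {x \<in> {k..j}. c x = Some (\<not> p)}"
  define l where "l = Min R"
  have R: "finite R" "j \<in> R" unfolding R_def using assms k by (auto intro: finite_subset[of _ "{k..j}"])
  then have lR: "l \<in> R" unfolding l_def by (intro Min_in) auto
  then have l: "c l = Some (\<not> p)" "k < l" "l \<le> j" using k unfolding R_def by (auto simp: less_le)
  have between: "c x = None" if "k < x" "x < l" for x
  proof (rule ccontr)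
    assume "c x \<noteq> None"
    with after[of x] that l have "c x = Some (\<not> p)" by (cases "c x") auto
    then have "x \<in> R" using that l unfolding R_def by simp
    then have "l \<le> x" unfolding l_def using R by simp
    with that show False by simp
  qed
  have "l \<noteq> k + 2" using step2[of k] k l by (auto simp: compatible_colours_def)
  then consider "l = k + 1" | "l = k + 3" | "l \<ge> k + 4" using l by linarith
  then have "transition p k"
  proof cases
    case 1
    \<comment> \<open>The edge from \<open>k\<close> to \<open>k + 1\<close> must be missing. Both
      \<open>k - 1\<close> and \<open>k + 2\<close> are joined to \<open>k\<close> and to
      \<open>k + 1\<close>, whose colours differ, so both are removed.\<close>
    have bd: "bd k" using step1[of k] k l 1 by (auto simp: compatible_colours_def)
    have "compatible_colours (c (k - 1)) (c k)" "compatible_colours (c (k - 1)) (c (k + 1))"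
      using step1[of "k - 1"] step2[of "k - 1"] bd_gap1[of "k - 1"] bd by (auto simp: add.commute)
    moreover have "compatible_colours (c (k + 1)) (c (k + 2))" "compatible_colours (c k) (c (k + 2))"
      using step1[of "k + 1"] step2[of k] bd_gap1[of k] bd by (auto simp: algebra_simps)
    ultimately have "c (k + 2) = None" "c (k - 1) = None"
      using k l 1 by (cases "c (k + 2)"; cases "c (k - 1)"; auto simp: compatible_colours_def)+
    then show ?thesis using bd k l 1 by (simp add: transition_def)
  qed (use between k l in \<open>auto simp: transition_def\<close>)
  then show ?thesis ..
qed

text \<open>The earlier transition is of the second kind, so \<open>bd (i - 1)\<close> holds and
  \<open>i - 2\<close> is removed; the later one is of the first kind. Either \<open>i + 3\<close>
  is a fourth removed position, or the edge from \<open>i\<close> to \<open>i + 3\<close> joins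
  different colours.\<close>

lemma no_transitions_at_distance_one:
  assumes "transition p i" "transition (\<not> p) (i - 1)"
  shows False
proof -
  have "c i = Some p" "c (i + 1) = None" "c (i + 2) = None" "c (i - 2) = None" "bd (i - 1)"
    and c3: "c (i + 3) = None \<or> c (i + 3) = Some (\<not> p)"
    using assms unfolding transition_def by auto
  moreover have "c (i + 3) \<noteq> None"
    using no_four_removed_in_period[of "i - 2" "i + 1" "i + 2" "i + 3"] calculation n8 by auto
  ultimately show False using step3_right[of "i - 1"] by (auto simp: compatible_colours_def add.commute)
qed

text \<open>If the later transition is of the first kind, four positions are removed within one
  period. Otherwise \<open>bd i\<close> holds, and either two block ends lie three apart or the edge
  from \<open>i - 3\<close> to \<open>i\<close> joins different colours.\<close>

lemma no_transitions_at_distance_three: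
  assumes "transition p i" "transition (\<not> p) (i - 3)"
  shows False
proof -
  have i: "c i = Some p" "c (i + 2) = None" "c (i - 3) = Some (\<not> p)" "c (i - 1) = None"
    using assms unfolding transition_def by auto
  consider "c (i + 1) = None" "c (i - 2) = None" | "c (i + 1) = None" "c (i - 4) = None"
    | "bd i" "bd (i - 3)" | "bd i" "c (i - 2) = None"
    using assms unfolding transition_def by (auto simp: algebra_simps)
  then show False
  proof cases
    case 1
    then show False
      using no_four_removed_in_period[of "i - 2" "i - 1" "i + 1" "i + 2"] i n8 by simp
  next
    case 2
    then show False
      using no_four_removed_in_period[of "i - 4" "i - 1" "i + 1" "i + 2"] i n8 by simp
  next
    case 3
    then show False using bd_gap3[of "i - 3"] by simp
  next
    case 4
    then show False using step3_left[of i] i by (auto simp: compatible_colours_def)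
  qed
qed

text \<open>A transition at \<open>k\<close> accounts for two removed positions,
  \<open>k + 2\<close> and one of \<open>k + 1\<close>, \<open>k - 1\<close>. At most three are
  removed per period, so the two transitions share one, which puts them at most three apart on the
  ring.\<close>

lemma not_opposite_transitions:
  assumes i: "transition p i" and j: "transition (\<not> p) j"
  shows False
proof -
  have shift: "j mod n = (i + b - a) mod n" if "(i + b) mod n = (j + a) mod n" for a b
    using mod_diff_cong[OF that refl, of a] by simp
  have no: "(i + b) mod n \<noteq> (j + a) mod n" if small: "b - a \<in> {-3, -2, -1, 0, 1, 2, 3}" for a b
  proof
    assume "(i + b) mod n = (j + a) mod n"
    then have eq: "j mod n = (i + (b - a)) mod n" using shift[of b a] by (simp add: algebra_simps)
    define d where "d = b - a"
    have t: "transition (\<not> p) (i + d)" and jc: "c j = c (i + d)" "c (j + 2) = c (i + d + 2)"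
      using transition_mod[OF eq] j c_mod[OF eq] c_mod[OF mod_add_cong[OF eq refl], of 2]
      unfolding d_def by auto
    have ci: "c i = Some p" "c (i + 2) = None" "c (j + 2) = None" "c j = Some (\<not> p)"
      using i j unfolding transition_def by auto
    \<comment> \<open>Shifts by 0 and by 2 either way fail at once: one position would have both
      colours, or a removed position would be coloured.\<close>
    consider "d = -3" | "d = -2" | "d = -1" | "d = 0" | "d = 1" | "d = 2" | "d = 3"
      using small unfolding d_def by blast
    then show False
    proof cases
      case 1 then show False using no_transitions_at_distance_three[OF i] t by simp
    next
      case 3 then show False using no_transitions_at_distance_one[OF i] t by simp
    next
      case 5 then show False using no_transitions_at_distance_one[of "\<not> p" "i + 1"] t i by simp
    next
      case 7 then show False using no_transitions_at_distance_three[of "\<not> p" "i + 3"] t i by simp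
    qed (use jc ci in auto)
  qed
  have "c (i + 1) = None \<or> c (i + -1) = None" "c (j + 1) = None \<or> c (j + -1) = None"
    using i j by (auto simp: transition_def)
  then obtain a b :: int where a: "a = -1 \<or> a = 1" "c (i + a) = None"
    and b: "b = -1 \<or> b = 1" "c (j + b) = None"
    by metis
  have "c (i + 2) = None" "c (j + 2) = None" using i j by (auto simp: transition_def)
  note at_most_three_removed[OF this a(2) b(2)]
  moreover have "(i + 2) mod n \<noteq> (i + a) mod n" "(j + 2) mod n \<noteq> (j + b) mod n"
    using a(1) b(1) n8 by (intro distinct_mod; auto)+
  moreover have "(i + 2) mod n \<noteq> (j + 2) mod n" "(i + 2) mod n \<noteq> (j + b) mod n"
    "(i + a) mod n \<noteq> (j + 2) mod n" "(i + a) mod n \<noteq> (j + b) mod n"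
    using a(1) b(1) by (intro no; auto)+
  ultimately show False by metis
qed

lemma monochromatic:
  assumes "c i = Some p" "c j = Some q"
  shows "p = q"
proof (rule ccontr)
  assume "p \<noteq> q"
  then have q: "q = (\<not> p)" by auto
  have ex: "\<exists>k. transition a k" if "c x = Some a" "c y = Some (\<not> a)" for x y a
  proof -
    \<comment> \<open>\<open>y\<close> is replaced by a translate to the right of \<open>x\<close>,
      so that two colours yield transitions in both directions.\<close>
    define y' where "y' = y + n * (\<bar>x - y\<bar> + 1)"
    have "c y' = c y" unfolding y'_def by (rule c_mod) simp
    moreover have "\<bar>x - y\<bar> + 1 \<le> n * (\<bar>x - y\<bar> + 1)" using n8 by simp
    then have "x < y'" unfolding y'_def by linarith
    ultimately show ?thesis using transition_exists that by metis
  qed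
  from ex[of i p j] ex[of j q i] assms q not_opposite_transitions show False by auto
qed

end

section \<open>The extremal graphs\<close>

text \<open>
  Blocks start at the multiples \<open>m\<close> of 4 with \<open>m + 4 \<le> n\<close>, so the last block has between four and
  seven vertices. All pairs at distance two on the ring are adjacent (the last two disjuncts below
  are the pairs that wrap around), and so are pairs at distance one within a block. The pairs at
  distance three complete the first four vertices of each block, and the last four vertices of the ring,
  to a \<open>K\<^sub>4\<close>.
\<close>

definition block_start :: "nat \<Rightarrow> nat \<Rightarrow> bool" where
  "block_start n m \<longleftrightarrow> 4 dvd m \<and> m + 4 \<le> n"

definition forward_edge :: "nat \<Rightarrow> nat \<Rightarrow> nat \<Rightarrow> bool" where
  "forward_edge n u v \<longleftrightarrow> u < v \<and> v < n \<and>
     (v = u + 1 \<and> \<not> block_start n v \<or> v = u + 2 \<or> v = u + 3 \<and> (block_start n u \<or> v = n - 1) \<or>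
      u = 0 \<and> v = n - 2 \<or> u = 1 \<and> v = n - 1)"

definition ring_adj :: "nat \<Rightarrow> nat \<Rightarrow> nat \<Rightarrow> bool" where
  "ring_adj n u v \<longleftrightarrow> forward_edge n u v \<or> forward_edge n v u"

definition block_ring :: "nat \<Rightarrow> (nat, nat \<times> nat) pre_digraph" where
  "block_ring n = \<lparr>verts = {..<n}, arcs = {(u, v). ring_adj n u v}, tail = fst, head = snd\<rparr>"

lemma block_ring_simps [simp]:
  "verts (block_ring n) = {..<n}" "arcs (block_ring n) = {(u, v). ring_adj n u v}"
  "tail (block_ring n) = fst" "head (block_ring n) = snd"
  by (simp_all add: block_ring_def)

lemma ring_adj_sym: "ring_adj n u v \<longleftrightarrow> ring_adj n v u"
  by (auto simp: ring_adj_def)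

lemma ring_adj_less: "ring_adj n u v \<Longrightarrow> u < n \<and> v < n \<and> u \<noteq> v"
  by (auto simp: ring_adj_def forward_edge_def)

lemma arcs_ends_block_ring: "arcs_ends (block_ring n) = {(u, v). ring_adj n u v}"
  by (auto simp: arcs_ends_conv image_def)

lemma graph_block_ring: "graph (block_ring n)"
proof -
  have "{(u, v). ring_adj n u v} \<subseteq> {..<n} \<times> {..<n}" using ring_adj_less by auto
  then have "finite {(u, v). ring_adj n u v}" by (rule finite_subset) simp
  moreover have "sym {(u, v). ring_adj n u v}" unfolding sym_def using ring_adj_sym by blast
  ultimately show ?thesis
    by unfold_locales
      (auto simp: symmetric_def arcs_ends_block_ring arc_to_ends_def dest: ring_adj_less)
qed

text \<open>No position of the interval after \<open>q\<close> starts a block: it would be a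
  multiple of 4 too close to \<open>q\<close>, or lie beyond \<open>n - 4\<close>. Hence no edge at
  distance one is missing.\<close>

lemma clique_in_ring:
  assumes "block_start n q \<or> q + 4 = n" "u \<in> {q..q + 3}" "v \<in> {q..q + 3}" "u \<noteq> v"
  shows "ring_adj n u v"
proof -
  have "forward_edge n i j" if "i < j" "i \<in> {q..q + 3}" "j \<in> {q..q + 3}" for i j
  proof -
    have "\<not> block_start n j"
    proof
      assume j: "block_start n j"
      then have "block_start n q" using assms(1) that by (auto simp: block_start_def)
      with j have "4 dvd j - q" by (auto simp: block_start_def)
      with that show False by (auto dest!: dvd_imp_le)
    qed
    moreover have "j = i + 1 \<or> j = i + 2 \<or> (j = q + 3 \<and> i = q)" using that by auto
    ultimately show ?thesis using assms(1) that
      by (auto simp: forward_edge_def block_start_def)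
  qed
  then show ?thesis using assms unfolding ring_adj_def by (cases "u < v") auto
qed

lemma locally_nonforesty_block_ring:
  assumes "8 \<le> n"
  shows "locally_nonforesty (block_ring n)"
  unfolding locally_nonforesty_def
proof
  interpret graph "block_ring n" by (rule graph_block_ring)
  fix v assume "v \<in> verts (block_ring n)"
  then have v: "v < n" by simp
  \<comment> \<open>The four vertices from \<open>4 * (v div 4)\<close> on contain \<open>v\<close>;
    when they do not fit below \<open>n\<close>, \<open>v\<close> is among the last four.\<close>
  have "\<exists>q. (block_start n q \<or> q + 4 = n) \<and> v \<in> {q..q + 3}"
  proof (cases "4 * (v div 4) + 4 \<le> n")
    case True
    then show ?thesis by (intro exI[of _ "4 * (v div 4)"]) (auto simp: block_start_def)
  next
    case False
    with v assms show ?thesis by (intro exI[of _ "n - 4"]) auto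
  qed
  then obtain q where q: "block_start n q \<or> q + 4 = n" "v \<in> {q..q + 3}" by blast
  then have "v = q \<or> v = q + 1 \<or> v = q + 2 \<or> v = q + 3" by (simp, linarith)
  then consider "v = q" | "v = q + 1" | "v = q + 2" | "v = q + 3" by blast
  then obtain a b c where "{a, b, c} \<subseteq> {q..q + 3}" "distinct [v, a, b, c]"
  proof cases
    case 1 then show ?thesis by (intro that[of "q + 1" "q + 2" "q + 3"]) auto
  next
    case 2 then show ?thesis by (intro that[of q "q + 2" "q + 3"]) auto
  next
    case 3 then show ?thesis by (intro that[of q "q + 1" "q + 3"]) auto
  next
    case 4 then show ?thesis by (intro that[of q "q + 1" "q + 2"]) auto
  qed
  then show "contains_cycle (local_subgraph (block_ring n) v)"
    unfolding local_subgraph_def using clique_in_ring[OF q(1)] q(2)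
    by (intro contains_cycle_if_triangle[of a b c])
      (auto simp: neighborhood_def arcs_ends_block_ring)
qed

text \<open>Each vertex contributes one edge: to its predecessor or, if it starts a block, to the
  vertex three further on. Pairs at distance two on the ring add \<open>n\<close> more. When 4 does
  not divide \<open>n\<close>, \<open>n - 4\<close> starts no block and
  \<open>(n - 4, n - 1)\<close> is one extra edge.\<close>

lemma graph_size_block_ring:
  assumes n: "8 \<le> n"
  shows "graph_size (block_ring n) = h n"
proof -
  let ?U = "{(u, v). forward_edge n u v}"
  let ?D = "{v. 1 \<le> v \<and> v < n \<and> \<not> block_start n v}" and ?S = "{v. block_start n v}"
  let ?P1 = "(\<lambda>v. (v - 1, v)) ` ?D" and ?P2 = "(\<lambda>u. (u, u + 2)) ` {..<n - 2}"
    and ?P3 = "(\<lambda>u. (u, u + 3)) ` ?S" and ?P4 = "{(0 :: nat, n - 2), (1, n - 1)}"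
    and ?P5 = "if 4 dvd n then {} else {(n - 4, n - 1)}"
  have dvd: "4 dvd n - 4 \<longleftrightarrow> 4 dvd n"
    using n by presburger
  have bs: "block_start n (n - 4) \<longleftrightarrow> 4 dvd n" using n by (simp add: block_start_def dvd)
  have "graph_edges (block_ring n) = (\<lambda>(u, v). {u, v}) ` ?U"
    by (auto simp: graph_edges_def ring_adj_def image_def doubleton_eq_iff)
  moreover have "inj_on (\<lambda>(u, v). {u, v}) ?U"
    by (auto simp: inj_on_def forward_edge_def doubleton_eq_iff)
  ultimately have "graph_size (block_ring n) = card ?U"
    by (simp add: graph_size_def card_image)
  also have "?U = ?P1 \<union> ?P2 \<union> ?P3 \<union> ?P4 \<union> ?P5"
  proof (intro set_eqI, clarify)
    fix u v
    show "(u, v) \<in> ?U \<longleftrightarrow> (u, v) \<in> ?P1 \<union> ?P2 \<union> ?P3 \<union> ?P4 \<union> ?P5"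
    proof -
      have 1: "(u, v) \<in> ?P1 \<longleftrightarrow> v = u + 1 \<and> v < n \<and> \<not> block_start n v" by (auto simp: image_def)
      have 2: "(u, v) \<in> ?P2 \<longleftrightarrow> v = u + 2 \<and> v < n" by (auto simp: image_def)
      have 3: "(u, v) \<in> ?P3 \<longleftrightarrow> v = u + 3 \<and> block_start n u" by (auto simp: image_def)
      have 5: "(u, v) \<in> ?P5 \<longleftrightarrow> \<not> block_start n u \<and> u = n - 4 \<and> v = n - 1" using bs by auto
      show ?thesis unfolding Un_iff 1 2 3 5 using n
        by (auto simp: forward_edge_def block_start_def)
    qed
  qed
  also have "card \<dots> = card ?P1 + card ?P2 + card ?P3 + card ?P4 + card ?P5"
  proof -
    have fin: "finite ?D" "finite ?S"
      by (rule finite_subset[of _ "{..<n}"]; auto simp: block_start_def)+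
    have card_Un5: "card (A \<union> B \<union> C \<union> D \<union> E) = card A + card B + card C + card D + card E"
      if "finite A" "finite B" "finite C" "finite D" "finite E" "A \<inter> B = {}" "A \<inter> C = {}" "A \<inter> D = {}"
        "A \<inter> E = {}" "B \<inter> C = {}" "B \<inter> D = {}" "B \<inter> E = {}" "C \<inter> D = {}" "C \<inter> E = {}" "D \<inter> E = {}"
      for A B C D E :: "(nat \<times> nat) set"
      using that by (simp add: card_Un_disjoint Int_Un_distrib2)
    show ?thesis
      by (rule card_Un5) (use fin n bs in \<open>auto split: if_splits\<close>)
  qed
  also have "card ?P1 = card ?D" by (rule card_image) (auto simp: inj_on_def)
  also have "card ?P3 = card ?S" by (rule card_image) (auto simp: inj_on_def)
  also have "card ?P2 = n - 2" by (subst card_image) (auto simp: inj_on_def)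
  also have "card ?P4 = 2" using n by simp
  also have "card ?D + (n - 2) + card ?S + 2 + card ?P5 = h n"
  proof -
    \<comment> \<open>\<open>0\<close> starts a block, so requiring \<open>1 \<le> v\<close> in
      \<open>?D\<close> loses no vertex.\<close>
    have U: "?D \<union> ?S = {..<n}" using n by (auto simp: block_start_def Suc_le_eq intro!: gr0I)
    then have "finite (?D \<union> ?S)" by simp
    moreover have "?D \<inter> ?S = {}" by auto
    ultimately have "card ?D + card ?S = n" using U card_Un_disjoint[of ?D ?S] by simp
    then have eq: "card ?D + (n - 2) + card ?S + 2 = 2 * n" using n by linarith
    show ?thesis unfolding eq by (simp add: h_def dvd_eq_mod_eq_0)
  qed
  finally show ?thesis .
qed

section \<open>Four-connectivity of the block ring\<close>

definition rotate_by :: "nat \<Rightarrow> nat \<Rightarrow> nat \<Rightarrow> nat" where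
  "rotate_by n k m = (if m + k < n then m + k else m + k - n)"

context
  fixes n m :: nat
  assumes n: "8 \<le> n" and m: "m < n"
begin

text \<open>A wrapped position four ahead is below 4, so it can start a block only if it is
  \<open>0\<close>.\<close>

lemma wrap_dvd_4:
  assumes "4 dvd m + 4 - n" "\<not> m + 4 < n" shows "m + 4 = n"
  using assms m dvd_imp_le[of 4 "m + 4 - n"] by (cases "m + 4 = n") auto

lemma ring_adj_rotate_1:
  assumes "\<not> block_start n (rotate_by n 1 m)"
  shows "ring_adj n m (rotate_by n 1 m)"
proof (cases "m + 1 < n")
  case False
  \<comment> \<open>Wrapping leads to \<open>0\<close>, which starts a block, against the
    assumption.\<close>
  then have "m + 1 = n" using m by simp
  then show ?thesis using assms n by (simp add: rotate_by_def block_start_def)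
qed (use assms in \<open>simp add: rotate_by_def ring_adj_def forward_edge_def\<close>)

lemma ring_adj_rotate_2: "ring_adj n m (rotate_by n 2 m)"
proof (cases "m + 2 < n")
  case False
  then have "m = n - 2 \<or> m = n - 1" using m by linarith
  then show ?thesis using n by (elim disjE) (simp_all add: rotate_by_def ring_adj_def forward_edge_def)
qed (simp add: rotate_by_def ring_adj_def forward_edge_def)

lemma ring_adj_rotate_3_right:
  assumes "block_start n m"
  shows "ring_adj n m (rotate_by n 3 m)"
  using assms by (simp add: rotate_by_def ring_adj_def forward_edge_def block_start_def)

text \<open>Without wrapping, \<open>m\<close> itself starts a block. With wrapping the next block
  starts at \<open>0\<close>, and the edge is \<open>(n - 4, n - 1)\<close>.\<close>

lemma ring_adj_rotate_3_left:
  assumes "block_start n (rotate_by n 4 m)"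
  shows "ring_adj n m (rotate_by n 3 m)"
proof (cases "m + 4 < n")
  case True
  then show ?thesis using assms
    by (simp add: rotate_by_def ring_adj_def forward_edge_def block_start_def)
next
  case False
  then have "m + 4 = n" using assms by (intro wrap_dvd_4) (simp_all add: rotate_by_def block_start_def)
  then show ?thesis by (auto simp: rotate_by_def ring_adj_def forward_edge_def)
qed

lemma not_block_start_rotate:
  assumes "block_start n m" "k = 1 \<or> k = 3"
  shows "\<not> block_start n (rotate_by n k m)"
proof -
  have "4 dvd m" "rotate_by n k m = m + k" using assms by (auto simp: rotate_by_def block_start_def)
  moreover have "\<not> 4 dvd k" using assms(2) by auto
  ultimately show ?thesis by (simp add: block_start_def dvd_add_right_iff)
qed

end

text \<open>Carries integer positions over to \<open>rotate_by\<close>, whose one explicit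
  wrap-around replaces \<open>mod\<close>; a shift by at most 4 wraps at most once.\<close>

lemma nat_mod_add:
  assumes "4 < n" "k \<le> 4"
  shows "nat ((x + int k) mod int n) = rotate_by n k (nat (x mod int n))"
proof -
  have "(x + int k) mod int n = (x mod int n + int k) mod int n" by (simp add: mod_add_left_eq)
  also have "\<dots> = int ((nat (x mod int n) + k) mod n)" using assms by (simp add: zmod_int)
  finally have "nat ((x + int k) mod int n) = (nat (x mod int n) + k) mod n" by simp
  moreover have "nat (x mod int n) < n" using assms by (simp add: nat_less_iff)
  ultimately show ?thesis using assms by (simp add: mod_if rotate_by_def)
qed

text \<open>Each integer is coloured by membership of its residue in \<open>T\<close>, with
  \<open>None\<close> on \<open>X\<close>. Closedness makes the colours of adjacent vertices
  compatible, so \<open>monochromatic\<close> puts every remaining vertex into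
  \<open>T\<close>.\<close>

lemma ring_closed_set:
  assumes n: "8 \<le> n" and X: "X \<subseteq> {..<n}" "card X < 4" and T: "T \<subseteq> {..<n} - X" "T \<noteq> {}"
    and closed: "\<And>u v. u \<in> T \<Longrightarrow> v \<in> {..<n} - X \<Longrightarrow> ring_adj n u v \<Longrightarrow> v \<in> T"
  shows "T = {..<n} - X"
proof -
  define r where "r x = nat (x mod int n)" for x
  define c where "c x = (if r x \<in> X then None else Some (r x \<in> T))" for x
  define bd where "bd x \<longleftrightarrow> block_start n (r (x + 1))" for x
  have r_less: "r x < n" for x using n by (simp add: r_def nat_less_iff)
  have r_add_nat: "r (x + int k) = rotate_by n k (r x)" if "k \<le> 4" for k x
    unfolding r_def by (rule nat_mod_add) (use n that in simp_all)
  have r_add: "r (x + 1) = rotate_by n 1 (r x)" "r (x + 2) = rotate_by n 2 (r x)"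
    "r (x + 3) = rotate_by n 3 (r x)" "r (x + 4) = rotate_by n 4 (r x)" for x
    using r_add_nat[of 1 x] r_add_nat[of 2 x] r_add_nat[of 3 x] r_add_nat[of 4 x] by simp_all
  have compatible: "compatible_colours (c x) (c y)" if "ring_adj n (r x) (r y)" for x y
    using closed[OF _ _ that] closed[OF _ _ that[unfolded ring_adj_sym[of n "r x"]]] r_less
    by (auto simp: compatible_colours_def c_def)
  interpret coloured_ring "int n" c bd
  proof
    fix x y
    show "c x = c y" if "x mod int n = y mod int n" using that by (simp add: c_def r_def)
    show "bd x = bd y" if "x mod int n = y mod int n"
      using mod_add_cong[OF that refl, of 1] by (simp add: bd_def r_def)
    show "compatible_colours (c x) (c (x + 1))" if "\<not> bd x"
      using ring_adj_rotate_1[OF n r_less] that by (intro compatible) (simp add: bd_def r_add)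
    show "compatible_colours (c x) (c (x + 2))"
      using ring_adj_rotate_2[OF n r_less] by (intro compatible) (simp add: r_add)
    show "compatible_colours (c (x + 1)) (c (x + 4))" if "bd x"
    proof (rule compatible)
      show "ring_adj n (r (x + 1)) (r (x + 4))"
        using ring_adj_rotate_3_right[OF n r_less, of "x + 1"] that r_add(3)[of "x + 1"]
        by (simp add: bd_def add.commute)
    qed
    \<comment> \<open>\<open>x - 3\<close> is four before the block start \<open>x + 1\<close>, so
      this edge spans the last four vertices of the preceding block.\<close>
    show "compatible_colours (c (x - 3)) (c x)" if "bd x"
    proof (rule compatible)
      show "ring_adj n (r (x - 3)) (r x)"
        using ring_adj_rotate_3_left[OF n r_less, of "x - 3"] that
          r_add(3)[of "x - 3"] r_add(4)[of "x - 3"]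
        by (simp add: bd_def add.commute)
    qed
    show "\<not> bd (x + 1)" if "bd x"
      using not_block_start_rotate[OF n r_less, of "x + 1" 1] that r_add(1)[of "x + 1"]
      by (simp add: bd_def)
    show "\<not> bd (x + 3)" if "bd x"
      using not_block_start_rotate[OF n r_less, of "x + 1" 3] that r_add(3)[of "x + 1"]
      by (simp add: bd_def)
    have "{x \<in> {0..<int n}. c x = None} \<subseteq> int ` X"
    proof
      fix x assume "x \<in> {x \<in> {0..<int n}. c x = None}"
      then have "x = int (r x)" "r x \<in> X" by (auto simp: c_def r_def split: if_splits)
      then show "x \<in> int ` X" by (rule image_eqI)
    qed
    then have "card {x \<in> {0..<int n}. c x = None} \<le> card X"
      using surj_card_le[of X _ int] finite_subset[OF X(1)] by simp
    then show "card {x \<in> {0..<int n}. c x = None} \<le> 3" using X by simp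
  qed (use n in simp)
  have r_int: "r (int u) = u" if "u < n" for u using that by (simp add: r_def)
  obtain u where u: "u \<in> T" using T by blast
  have "v \<in> T" if "v \<in> {..<n} - X" for v
    using monochromatic[of "int u" True "int v" "v \<in> T"] u T(1) that r_int by (auto simp: c_def)
  with T show ?thesis by blast
qed

lemma four_connected_block_ring:
  assumes "8 \<le> n"
  shows "k_connected 4 (block_ring n)"
  unfolding k_connected_def
proof (intro conjI allI impI)
  interpret graph "block_ring n" by (rule graph_block_ring)
  show "4 < graph_order (block_ring n)" using assms by (simp add: graph_order_def)
  fix X assume X: "X \<subseteq> verts (block_ring n) \<and> card X < 4"
  have "{..<n} - X \<noteq> {}"
  proof
    assume "{..<n} - X = {}"
    then have "X = {..<n}" using X by auto
    with X assms show False by simp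
  qed
  then show "connected (block_ring n \<restriction> (verts (block_ring n) - X))"
    using X ring_closed_set[OF assms]
    by (subst connected_induce_iff) (auto simp: arcs_ends_block_ring)
qed

theorem theorem2:
  fixes n :: nat
  assumes "n \<ge> 8"
  shows "(\<forall>G :: ('a, 'b) pre_digraph.
            graph G \<and> k_connected 4 G \<and> locally_nonforesty G \<and> graph_order G = n
              \<longrightarrow> h n \<le> graph_size G) \<and>
         (\<exists>G :: (nat, nat \<times> nat) pre_digraph.
            graph G \<and> k_connected 4 G \<and> locally_nonforesty G \<and> graph_order G = n
              \<and> graph_size G = h n)"
proof (intro conjI allI impI)
  fix G :: "('a, 'b) pre_digraph"
  assume "graph G \<and> k_connected 4 G \<and> locally_nonforesty G \<and> graph_order G = n"
  with graph.graph_size_ge_h[of G] assms show "h n \<le> graph_size G" by blast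
next
  have "graph_order (block_ring n) = n" by (simp add: graph_order_def)
  with assms graph_block_ring four_connected_block_ring locally_nonforesty_block_ring
    graph_size_block_ring
  show "\<exists>G :: (nat, nat \<times> nat) pre_digraph. graph G \<and> k_connected 4 G \<and> locally_nonforesty G \<and>
      graph_order G = n \<and> graph_size G = h n"
    by blast
qed

end
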